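(* Let $T$ be a caterpillar. Then the packing coloring gap of the corona graph $T\odot K_1$ satisfies $\mu_p(T\odot K_1)\le 2$.
   Context: All graphs are finite and simple; the graph $T$ is connected (graphs obtained by deleting a vertex may be disconnected or empty). For a graph $G$, $d_G(u,v)$ is the length of a shortest $u$--$v$ path in $G$, with $d_G(u,v)=\infty$ if $u,v$ lie in different components. A packing coloring of $G$ with $k$ colors is a map $c:V(G)\to\{1,2,\dots,k\}$ such that for every $i\in\{1,\dots,k\}$, any two distinct vertices $u,v$ with $c(u)=c(v)=i$ satisfy $d_G(u,v)>i$. The packing chromatic number $\chi_p(G)$ is the minimum $k$ for which $G$ has such a coloring (the graph with no vertices has $\chi_p=0$). $G-v$ denotes the graph obtained by deleting the vertex $v$. The packing coloring gap of $G$ is $\mu_p(G)=\max_{v\in V(G)}\bigl(\chi_p(G)-\chi_p(G-v)\bigr)$. A caterpillar is a tree in which all vertices of degree at least two lie on a single path (the central path). The corona $G\odot K_1$ is the graph obtained from $G$ by attaching a single new pendant vertex to each vertex of $G$. *)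

theory Defs
  imports "Graph_Theory.Graph_Theory"
begin

text \<open>
  Finite simple graphs are the graphs of the locale \<^locale>\<open>pair_graph\<close>: a finite vertex set
  with a symmetric irreflexive arc relation, so that every undirected edge is a pair of
  opposite arcs. Distances and colorings are defined for arbitrary \<^typ>\<open>('a, 'b) pre_digraph\<close>, the
  type on which \<^const>\<open>pre_digraph.del_vert\<close> (deletion of a vertex) operates.
\<close>

text \<open>With unit weights, the cost of a walk is its length; the infimum is \<open>\<infinity>\<close> if there is no walk.\<close>

definition graph_dist :: "('a, 'b) pre_digraph \<Rightarrow> 'a \<Rightarrow> 'a \<Rightarrow> ereal" where
  "graph_dist G u v = wf_digraph.\<mu> G (\<lambda>_. 1) u v"

definition packing_coloring :: "('a, 'b) pre_digraph \<Rightarrow> nat \<Rightarrow> ('a \<Rightarrow> nat) \<Rightarrow> bool" where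
  "packing_coloring G k c \<longleftrightarrow>
     c ` verts G \<subseteq> {1..k} \<and>
     (\<forall>i\<in>{1..k}. \<forall>u\<in>verts G. \<forall>v\<in>verts G.
        u \<noteq> v \<and> c u = i \<and> c v = i \<longrightarrow> graph_dist G u v > ereal (real i))"

definition packing_chromatic_number :: "('a, 'b) pre_digraph \<Rightarrow> nat" where
  "packing_chromatic_number G = (LEAST k. \<exists>c. packing_coloring G k c)"

text \<open>The differences are taken in \<^typ>\<open>int\<close> to avoid truncated subtraction.\<close>

definition packing_coloring_gap :: "('a, 'b) pre_digraph \<Rightarrow> int" where
  "packing_coloring_gap G =
     (MAX v\<in>verts G. int (packing_chromatic_number G)
                    - int (packing_chromatic_number (pre_digraph.del_vert G v)))"

text \<open>
  The library's \<^const>\<open>tree\<close> is not usable for symmetric digraphs, since traversing an edge back and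
  forth counts as a cycle of length 2 there. The cycles of length at least 3 are
  exactly the cycles of the underlying undirected graph.
\<close>

definition undirected_tree :: "'a pair_pre_digraph \<Rightarrow> bool" where
  "undirected_tree T \<longleftrightarrow>
     pair_graph T \<and> Digraph_Component.connected (with_proj T) \<and>
     \<not> (\<exists>p. pre_digraph.cycle (with_proj T) p \<and> length p \<ge> 3)"

text \<open>By symmetry, \<^const>\<open>out_degree\<close> is the degree in the undirected graph.\<close>

definition caterpillar :: "'a pair_pre_digraph \<Rightarrow> bool" where
  "caterpillar T \<longleftrightarrow>
     undirected_tree T \<and>
     (\<exists>p. vpath p (with_proj T) \<and> {v \<in> pverts T. out_degree (with_proj T) v \<ge> 2} \<subseteq> set p)"

text \<open>\<^term>\<open>Inl v\<close> is the original vertex \<open>v\<close>, and \<^term>\<open>Inr v\<close> the pendant vertex attached to it.\<close>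

definition corona_K1 :: "'a pair_pre_digraph \<Rightarrow> ('a + 'a) pair_pre_digraph" where
  "corona_K1 G =
     \<lparr> pverts = Inl ` pverts G \<union> Inr ` pverts G,
       parcs = (\<lambda>(u, v). (Inl u, Inl v)) ` parcs G
             \<union> (\<lambda>v. (Inl v, Inr v)) ` pverts G
             \<union> (\<lambda>v. (Inr v, Inl v)) ` pverts G \<rparr>"

lemma pair_graph_corona_K1:
  assumes "pair_graph G"
  shows "pair_graph (corona_K1 G)"
proof -
  interpret pair_graph G by fact
  have "sym (parcs (corona_K1 G))"
    by (rule symI) (auto simp: corona_K1_def intro: arcs_symmetric rev_image_eqI)
  then show ?thesis
    by unfold_locales
       (auto simp: corona_K1_def symmetric_def
             dest: in_arcsD1 in_arcsD2 pair_no_loops)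
qed

text \<open>The set in the definition of the packing chromatic number is nonempty for finite graphs.\<close>

lemma packing_coloring_exists:
  assumes "finite (verts G)"
  shows "\<exists>c. packing_coloring G (card (verts G)) c"
proof -
  obtain c where "bij_betw c (verts G) {1..card (verts G)}"
    using assms by (metis ex_bij_betw_finite_nat finite_same_card_bij finite_atLeastAtMost
        card_atLeastAtMost diff_Suc_1)
  then show ?thesis
    unfolding packing_coloring_def bij_betw_def by (auto intro!: exI[of _ c] dest: inj_onD)
qed

end

theory Submission
  imports Defs
begin

text \<open>
  Write \<open>G\<close> for the corona of the caterpillar \<open>T\<close> and let \<open>c\<close> be a packing coloring of \<open>G - v\<close> with
  \<open>k\<close> colors. The claim is that \<open>G\<close> has a packing coloring with \<open>k + 2\<close> colors.

  The caterpillar is a path, its spine, with leaves attached to it, so \<open>G\<close> consists of the spine,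
  a pendant vertex at each spine vertex, and legs: paths of two vertices hanging off the spine. If
  \<open>v\<close> is not a spine vertex, its deletion does not change any distance except those from the pendant
  vertex that it may leave isolated, and one new color for \<open>v\<close> is enough
  (\<open>one_more_color_off_spine\<close>). The problem is a spine vertex \<open>v\<close>: it cuts \<open>G\<close> into a left and a
  right side, which \<open>c\<close> colors independently, so the two parts of \<open>c\<close> need not fit together. Here
  \<open>c\<close> is used only for what its existence says about the shape of \<open>G\<close>, and \<open>G\<close> is colored anew.

  Colorings of \<open>G\<close> come from colorings of its spine. Give legs and pendant vertices the colors 1, 2
  and 3 in a standard way; then what remains is to color a path with colors at least 2, equal colors
  \<open>i\<close> more than \<open>i\<close> apart and 2 and 3 never adjacent. A spine vertex without legs may also
  receive the color 1, if it has no neighbor of color 2 on the spine (\<open>spine_coloring\<close>, \<open>packing_coloring_of_spine_coloring\<close>).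

  The periodic word 2 4 3 5 2 6 3 4 2 5 3 7 colors a spine of any length, so \<open>G\<close> always has a
  packing coloring with 7 colors, and only \<open>k \<le> 4\<close> remains. With so few colors the two sides are
  short: their spines have at most 0, 1, 3 and 9 vertices for \<open>k\<close> = 1, 2, 3, 4. Moreover a side that
  is long for its \<open>k\<close> must use the color 1 at one of a few places of its spine, and such a vertex has
  no legs, because all its neighbors need different colors from 2 to \<open>k\<close> (\<open>side_exists\<close>, \<open>side_shape\<close>).
  Both facts come from a search through the colorings of one side, of which there are few. The
  shapes that remain fall into at most five classes for each \<open>k\<close>, and for each pair of classes an
  explicit spine coloring with \<open>k + 2\<close> colors exists (\<open>pattern_exists\<close>).
\<close>

section \<open>Bounding distances by walks and by potentials\<close>

definition walk_within :: "('a, 'b) pre_digraph \<Rightarrow> 'a \<Rightarrow> 'a \<Rightarrow> nat \<Rightarrow> bool" where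
  "walk_within H u w d \<longleftrightarrow> (\<exists>q. pre_digraph.awalk H u q w \<and> length q \<le> d)"

context wf_digraph
begin

lemma awalk_cost_one: "awalk_cost (\<lambda>_. 1) q = real (length q)"
  by (simp add: awalk_cost_def sum_list_triv)

lemma walk_within_arc: "e \<in> arcs G \<Longrightarrow> walk_within G (tail G e) (head G e) 1"
  unfolding walk_within_def by (intro exI[of _ "[e]"]) (simp add: arc_implies_awalk)

lemma walk_within_refl: "u \<in> verts G \<Longrightarrow> walk_within G u u d"
  unfolding walk_within_def by (intro exI[of _ "[]"]) (simp add: awalk_Nil_iff)

lemma walk_within_trans: "walk_within G u v d \<Longrightarrow> walk_within G v w e \<Longrightarrow> walk_within G u w (d + e)"
  unfolding walk_within_def
proof (elim exE conjE)
  fix q r assume "awalk u q v" "length q \<le> d" "awalk v r w" "length r \<le> e"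
  then show "\<exists>q. awalk u q w \<and> length q \<le> d + e"
    by (intro exI[of _ "q @ r"]) (auto intro: awalk_appendI)
qed

lemma graph_dist_le_walk_within:
  assumes "walk_within G u w d"
  shows "graph_dist G u w \<le> ereal (real d)"
proof -
  obtain q where q: "awalk u q w" "length q \<le> d"
    using assms by (auto simp: walk_within_def)
  have "graph_dist G u w \<le> ereal (real (length q))"
    unfolding graph_dist_def using min_cost_le_walk_cost[OF q(1), of "\<lambda>_. 1"]
    by (simp add: awalk_cost_one)
  also have "\<dots> \<le> ereal (real d)" using q(2) by simp
  finally show ?thesis .
qed

text \<open>
  A function that grows by at most 1 along every arc is a certificate for a lower bound on a
  distance. This replaces any argument about the uniqueness of paths in a tree.
\<close>

lemma graph_dist_ge_potential:
  fixes f :: "'a \<Rightarrow> int"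
  assumes "\<And>e. e \<in> arcs G \<Longrightarrow> f (head G e) \<le> f (tail G e) + 1"
  shows "ereal (real_of_int (f w - f u)) \<le> graph_dist G u w"
proof -
  have "f w - f u \<le> int (length q)" if "awalk u q w" for q
    using that
  proof (induction q arbitrary: u)
    case (Cons e q)
    then show ?case using assms[of e] by (force simp: awalk_Cons_iff)
  qed (simp add: awalk_Nil_iff)
  then have "real_of_int (f w - f u) \<le> real (length q)" if "awalk u q w" for q
    using that by (metis of_int_le_iff of_int_of_nat_eq)
  then show ?thesis
    unfolding graph_dist_def \<mu>_def by (intro INF_greatest) (simp add: awalk_cost_one)
qed

end

section \<open>Caterpillars as spines with legs\<close>

text \<open>
  The vertex \<open>sp i\<close> is the \<open>i\<close>-th of the \<open>n\<close> spine vertices, and \<open>pos x\<close> is the index of the spine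
  vertex that \<open>x\<close> is or is attached to. The last assumption says that an arc joins consecutive spine
  vertices, or a spine vertex and a leaf attached to it.
\<close>

locale spined_tree = pair_graph T for T :: "'a pair_pre_digraph" +
  fixes n :: nat and sp :: "nat \<Rightarrow> 'a" and pos :: "'a \<Rightarrow> nat"
  assumes pos_less: "x \<in> pverts T \<Longrightarrow> pos x < n"
    and sp_in: "i < n \<Longrightarrow> sp i \<in> pverts T"
    and pos_sp: "i < n \<Longrightarrow> pos (sp i) = i"
    and sp_arc: "Suc i < n \<Longrightarrow> (sp i, sp (Suc i)) \<in> parcs T"
    and leg_arc: "x \<in> pverts T \<Longrightarrow> x \<noteq> sp (pos x) \<Longrightarrow> (x, sp (pos x)) \<in> parcs T"
    and arc_cases: "(x, y) \<in> parcs T \<Longrightarrow>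
      x = sp (pos x) \<and> y = sp (pos y) \<and> (pos y = Suc (pos x) \<or> pos x = Suc (pos y)) \<or>
      pos x = pos y \<and> (x = sp (pos x) \<longleftrightarrow> y \<noteq> sp (pos y))"

text \<open>
  The spine is the central path. Consecutive vertices are the only adjacent ones on it, since a chord
  would close a cycle. A vertex off the path has degree at most 1; hence the vertices that are on the
  path or have a neighbor on it are closed under adjacency, and by connectedness these are all
  vertices.
\<close>

lemma caterpillar_imp_spined_tree:
  assumes "caterpillar T"
  shows "\<exists>n sp pos. spined_tree T n sp pos"
proof -
  interpret pair_graph T
    using assms by (simp add: caterpillar_def undirected_tree_def)
  have conn: "Digraph_Component.connected (with_proj T)"
    and acyc: "\<And>q. cycle q \<Longrightarrow> length q < 3"
    using assms by (force simp: caterpillar_def undirected_tree_def)+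
  obtain s where s: "vpath s (with_proj T)"
    and deg: "{v \<in> pverts T. out_degree (with_proj T) v \<ge> 2} \<subseteq> set s"
    using assms by (auto simp: caterpillar_def)
  have s_ne: "s \<noteq> []" and s_in: "set s \<subseteq> pverts T" and dist: "distinct s"
    and s_arcs: "set (vwalk_arcs s) \<subseteq> parcs T"
    using s by (auto simp: vpath_def vwalk_def)
  have consec: "(s ! i, s ! Suc i) \<in> parcs T" if "Suc i < length s" for i
  proof -
    have "(s ! i, s ! Suc i) \<in> set (vwalk_arcs s)" using that
    proof (induction s arbitrary: i rule: vwalk_arcs.induct)
      case (3 x y xs)
      then show ?case by (cases i) auto
    qed auto
    then show ?thesis using s_arcs by blast
  qed
  have walk: "awalk (s ! i) (map (\<lambda>t. (s ! t, s ! Suc t)) [i..<j]) (s ! j) \<and>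
      pawalk_verts (s ! i) (map (\<lambda>t. (s ! t, s ! Suc t)) [i..<j]) = map ((!) s) [i..<Suc j]"
    if "i \<le> j" "j < length s" for i j
    using that
  proof (induction i rule: inc_induct)
    case base
    then show ?case using s_in by (auto simp: awalk_Nil_iff)
  next
    case (step i)
    then show ?case using consec[of i]
      by (simp add: awalk_Cons_iff upt_conv_Cons del: upt_Suc)
  qed
  have no_chord: "j = Suc i" if "i < j" "j < length s" "(s ! j, s ! i) \<in> parcs T" for i j
  proof (rule ccontr)
    assume "j \<noteq> Suc i"
    let ?q = "map (\<lambda>t. (s ! t, s ! Suc t)) [i..<j]"
    have w: "awalk (s ! i) ?q (s ! j)"
      "pawalk_verts (s ! i) ?q = map ((!) s) [i..<Suc j]"
      using walk[of i j] that by auto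
    have "cycle ((s ! j, s ! i) # ?q)"
      unfolding cycle_def
    proof (intro exI conjI)
      show "awalk (s ! j) ((s ! j, s ! i) # ?q) (s ! j)"
        using w(1) that(3) by (simp add: awalk_Cons_iff)
      have "distinct (map ((!) s) [i..<Suc j])"
        using dist that by (auto simp: distinct_map inj_on_def nth_eq_iff_index_eq)
      then show "distinct (tl (pawalk_verts (s ! j) ((s ! j, s ! i) # ?q)))"
        using w(2) by simp
    qed simp
    from acyc[OF this] show False using \<open>j \<noteq> Suc i\<close> that by simp
  qed
  have unique: "z = z'" if "x \<in> pverts T" "x \<notin> set s" "(x, z) \<in> parcs T" "(x, z') \<in> parcs T"
    for x z z'
  proof (rule ccontr)
    assume "z \<noteq> z'"
    have "card {(x, z), (x, z')} \<le> out_degree (with_proj T) x"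
      unfolding out_degree_def using that
      by (intro card_mono finite_out_arcs) auto
    then show False using deg that \<open>z \<noteq> z'\<close> by auto
  qed
  define near where "near = set s \<union> {y. \<exists>z\<in>set s. (y, z) \<in> parcs T}"
  have near_closed: "y \<in> near" if x: "x \<in> near" and xy: "(x, y) \<in> parcs T" for x y
  proof (cases "x \<in> set s")
    case True
    then show ?thesis using arcs_symmetric[OF xy] by (auto simp: near_def)
  next
    case False
    then obtain z where "z \<in> set s" "(x, z) \<in> parcs T"
      using x by (auto simp: near_def)
    then show ?thesis
      using unique[of x z y] False xy in_arcsD1 by (auto simp: near_def)
  qed
  have all_near: "y \<in> near" if "y \<in> pverts T" for y
  proof -
    have "strongly_connected (with_proj T)"
      using symmetric_connected_imp_strongly_connected conn pair_sym_arcs by blast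
    moreover have "hd s \<in> pverts T" using s_ne s_in by (meson hd_in_set subsetD)
    ultimately have "hd s \<rightarrow>\<^sup>*\<^bsub>with_proj T\<^esub> y"
      using that by (auto simp: strongly_connected_def)
    then show ?thesis
    proof (induction rule: reachable_induct)
      case base
      show ?case using s_ne by (simp add: near_def)
    next
      case (step x y)
      then show ?case using near_closed by auto
    qed
  qed
  define pos where "pos x = (SOME i. i < length s \<and> (x = s ! i \<or> x \<notin> set s \<and> (x, s ! i) \<in> parcs T))" for x
  have pos: "pos x < length s \<and> (x = s ! pos x \<or> x \<notin> set s \<and> (x, s ! pos x) \<in> parcs T)"
    if "x \<in> pverts T" for x
  proof -
    have "\<exists>i. i < length s \<and> (x = s ! i \<or> x \<notin> set s \<and> (x, s ! i) \<in> parcs T)"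
    proof (cases "x \<in> set s")
      case True
      then show ?thesis by (auto simp: in_set_conv_nth)
    next
      case False
      then obtain z where "z \<in> set s" "(x, z) \<in> parcs T"
        using all_near[OF \<open>x \<in> pverts T\<close>] by (auto simp: near_def)
      then show ?thesis using False by (metis in_set_conv_nth)
    qed
    from someI_ex[OF this] show ?thesis unfolding pos_def .
  qed
  have pos_nth: "pos (s ! i) = i" if "i < length s" for i
    using pos[of "s ! i"] that s_in dist
    by (metis nth_eq_iff_index_eq nth_mem subsetD)
  have off: "x \<notin> set s \<longleftrightarrow> x \<noteq> s ! pos x" if "x \<in> pverts T" for x
    using pos[OF that] nth_mem[of "pos x" s] no_loops'[of x x] by metis
  have "spined_tree T (length s) ((!) s) pos"
  proof unfold_locales
    fix x y assume xy: "(x, y) \<in> parcs T"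
    then have in_T: "x \<in> pverts T" "y \<in> pverts T" by (auto dest: in_arcsD1 in_arcsD2)
    have yx: "(y, x) \<in> parcs T" using xy by (rule arcs_symmetric)
    show "x = s ! pos x \<and> y = s ! pos y \<and> (pos y = Suc (pos x) \<or> pos x = Suc (pos y)) \<or>
      pos x = pos y \<and> (x = s ! pos x \<longleftrightarrow> y \<noteq> s ! pos y)"
    proof (cases "x \<in> set s"; cases "y \<in> set s")
      assume "x \<in> set s" "y \<in> set s"
      then obtain i j where ij: "x = s ! i" "y = s ! j" "i < length s" "j < length s"
        by (auto simp: in_set_conv_nth)
      moreover have "i \<noteq> j" using ij xy no_loops' by auto
      ultimately show ?thesis
        using no_chord[of i j] no_chord[of j i] xy yx
        by (cases i j rule: linorder_cases) (auto simp: pos_nth)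
    next
      assume "x \<in> set s" "y \<notin> set s"
      then have "s ! pos y = x"
        using pos[OF in_T(2)] off[OF in_T(2)] unique[OF in_T(2) _ yx] by auto
      then show ?thesis
        using pos_nth[of "pos y"] pos[OF in_T(2)] off[OF in_T(2)] \<open>y \<notin> set s\<close> by auto
    next
      assume "x \<notin> set s" "y \<in> set s"
      then have "s ! pos x = y"
        using pos[OF in_T(1)] off[OF in_T(1)] unique[OF in_T(1) _ xy] by auto
      then show ?thesis
        using pos_nth[of "pos x"] pos[OF in_T(1)] off[OF in_T(1)] \<open>x \<notin> set s\<close> by auto
    next
      assume "x \<notin> set s" "y \<notin> set s"
      then have "y = s ! pos x"
        using pos[OF in_T(1)] off[OF in_T(1)] unique[OF in_T(1) _ xy] by auto
      then show ?thesis using \<open>y \<notin> set s\<close> pos[OF in_T(1)] by auto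
    qed
  qed (use pos pos_nth off consec s_in in auto)
  then show ?thesis by blast
qed

section \<open>Distances in the corona\<close>

lemma packing_coloring_mono:
  assumes "packing_coloring G k c" "k \<le> k'"
  shows "packing_coloring G k' c"
proof -
  have "c u \<le> k" if "u \<in> verts G" for u
    using assms(1) that by (auto simp: packing_coloring_def)
  then show ?thesis
    using assms unfolding packing_coloring_def by fastforce
qed

context spined_tree
begin

abbreviation corona where "corona \<equiv> with_proj (corona_K1 T)"

definition base :: "'a + 'a \<Rightarrow> 'a" where
  "base = case_sum (\<lambda>x. x) (\<lambda>x. x)"

text \<open>
  The distance from \<open>z\<close> to the spine: 0 on the spine, 1 for a pendant vertex of the spine and for
  the inner vertex of a leg, 2 for the end of a leg.
\<close>

definition depth :: "'a + 'a \<Rightarrow> nat" where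
  "depth z = (if base z = sp (pos (base z)) then 0 else 1) + (if isl z then 0 else 1)"

text \<open>
  This is the distance in the corona of vertices with different bases, that is, of any two vertices
  other than a vertex of \<open>T\<close> and its pendant vertex. The vertices of
  such an exceptional pair are adjacent, so they only have to differ in color.
\<close>

definition tree_dist :: "'a + 'a \<Rightarrow> 'a + 'a \<Rightarrow> nat" where
  "tree_dist z w = (pos (base z) - pos (base w)) + (pos (base w) - pos (base z)) + depth z + depth w"

lemma base_simps [simp]: "base (Inl x) = x" "base (Inr x) = x"
  by (simp_all add: base_def)

lemma verts_corona [simp]: "z \<in> pverts (corona_K1 T) \<longleftrightarrow> base z \<in> pverts T"
  by (cases z) (auto simp: corona_K1_def)

lemma corona_arc_iff:
  "(Inl x, Inl y) \<in> parcs (corona_K1 T) \<longleftrightarrow> (x, y) \<in> parcs T"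
  "(Inl x, Inr y) \<in> parcs (corona_K1 T) \<longleftrightarrow> x = y \<and> x \<in> pverts T"
  "(Inr x, Inl y) \<in> parcs (corona_K1 T) \<longleftrightarrow> x = y \<and> x \<in> pverts T"
  "(Inr x, Inr y) \<notin> parcs (corona_K1 T)"
  by (auto simp: corona_K1_def)

lemma wf_corona: "wf_digraph corona"
  using pair_graph_corona_K1[OF pair_graph] pair_graph.pair_graphD_graph graph_def
  by (meson pair_digraph.axioms(1) pair_fin_digraph.axioms(1) pair_graph.axioms(1) wf_digraph_wp_iff)

lemma base_eq_cases:
  assumes "base z = base w" "z \<noteq> w"
  shows "z = Inl (base z) \<and> w = Inr (base z) \<or> z = Inr (base z) \<and> w = Inl (base z)"
  using assms by (cases z; cases w) auto

text \<open>
  The potential is the position along the spine, oriented from \<open>z\<close> to \<open>w\<close>; it is lowered by the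
  depth at the base of \<open>z\<close> and raised by the depth at the base of \<open>w\<close>. This also covers two
  branches at the same spine vertex.
\<close>

lemma tree_dist_le_graph_dist:
  assumes "base z \<noteq> base w"
  shows "ereal (real (tree_dist z w)) \<le> graph_dist corona z w"
proof -
  define s :: int where "s = (if pos (base z) \<le> pos (base w) then 1 else -1)"
  define f where "f y = s * int (pos (base y)) +
    (if base y = base z then - int (depth y) else if base y = base w then int (depth y) else 0)" for y
  have "f y' \<le> f y + 1" if "(y, y') \<in> parcs (corona_K1 T)" for y y'
  proof (cases y; cases y')
    fix x x' assume y: "y = Inl x" "y' = Inl x'"
    then have "(x, x') \<in> parcs T" using that by (simp add: corona_arc_iff)
    from arc_cases[OF this] show ?thesis
      using y by (auto simp: f_def s_def depth_def split: if_splits)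
  qed (use that in \<open>auto simp: corona_arc_iff f_def depth_def\<close>)
  then have "ereal (real_of_int (f w - f z)) \<le> graph_dist corona z w"
    by (intro wf_digraph.graph_dist_ge_potential[OF wf_corona]) auto
  moreover have "f w - f z = int (tree_dist z w)"
    using assms by (auto simp: f_def s_def tree_dist_def)
  ultimately show ?thesis by simp
qed

lemma packing_coloringI:
  assumes "\<And>z. base z \<in> pverts T \<Longrightarrow> c z \<in> {1..k}"
    and "\<And>x. x \<in> pverts T \<Longrightarrow> c (Inl x) \<noteq> c (Inr x)"
    and "\<And>z w. base z \<in> pverts T \<Longrightarrow> base w \<in> pverts T \<Longrightarrow> base z \<noteq> base w \<Longrightarrow> c z = c w \<Longrightarrow>
      c z < tree_dist z w"
  shows "packing_coloring corona k c"
proof -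
  have far: "graph_dist corona u v > ereal (real (c u))"
    if uv: "base u \<in> pverts T" "base v \<in> pverts T" "u \<noteq> v" "c u = c v" for u v
  proof -
    have "base u \<noteq> base v"
      using base_eq_cases[of u v] assms(2)[of "base u"] uv by force
    then have "ereal (real (c u)) < ereal (real (tree_dist u v))"
      "ereal (real (tree_dist u v)) \<le> graph_dist corona u v"
      using assms(3)[of u v] uv tree_dist_le_graph_dist by auto
    then show ?thesis by (rule less_le_trans)
  qed
  show ?thesis
    unfolding packing_coloring_def
  proof (intro conjI ballI impI)
    fix i u v assume "u \<in> verts corona" "v \<in> verts corona" "u \<noteq> v \<and> c u = i \<and> c v = i"
    then show "graph_dist corona u v > ereal (real i)" using far[of u v] by auto
  qed (use assms(1) in auto)
qed

end

section \<open>Packing colorings from colorings of the spine\<close>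

text \<open>
  The color 2 must not be next to 3 because of the legs: those at a spine vertex of color 2 end in the
  color 3, those at any other spine vertex end in 2. It must not be next to 1 because a spine vertex of
  color 1 has a pendant vertex of color 2.
\<close>

definition spine_coloring :: "nat \<Rightarrow> nat \<Rightarrow> (nat \<Rightarrow> nat) \<Rightarrow> bool" where
  "spine_coloring k n a \<longleftrightarrow>
     (\<forall>j<n. a j \<in> {1..k} \<and> (\<forall>i<j. a i = a j \<longrightarrow> a i < j - i)) \<and>
     (\<forall>i. Suc i < n \<longrightarrow> {a i, a (Suc i)} \<noteq> {1, 2} \<and> {a i, a (Suc i)} \<noteq> {2, 3})"

lemma spine_coloring_shift:
  assumes "spine_coloring k N a" "n + d \<le> N"
  shows "spine_coloring k n (\<lambda>j. a (j + d))"
proof -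
  have *: "a j \<in> {1..k}" "i < j \<Longrightarrow> a i = a j \<Longrightarrow> a i < j - i" if "j < N" for i j
    using assms(1) that by (auto simp: spine_coloring_def)
  have **: "{a i, a (Suc i)} \<noteq> {1, 2} \<and> {a i, a (Suc i)} \<noteq> {2, 3}" if "Suc i < N" for i
    using assms(1) that by (auto simp: spine_coloring_def)
  show ?thesis
    unfolding spine_coloring_def
  proof (intro conjI allI impI)
    fix i j assume "j < n" "i < j" "a (i + d) = a (j + d)"
    then show "a (i + d) < j - i" using *(2)[of "j + d" "i + d"] assms(2) by auto
  qed (use * ** assms(2) in auto)
qed

context spined_tree
begin

text \<open>
  The inner vertices of legs get the color 1, the ends of legs the color 2, or 3 if their spine vertex
  has the color 2. A pendant vertex of the spine gets 1, or 2 if its spine vertex has the color 1.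
  Colors 2 and 3 at the ends of legs are harmless for each other: the ends of two legs at the
  same spine vertex already have distance 4.
\<close>

lemma packing_coloring_of_spine_coloring:
  assumes a: "spine_coloring k n a" and k: "3 \<le> k"
    and no_leg: "\<And>x. x \<in> pverts T \<Longrightarrow> x \<noteq> sp (pos x) \<Longrightarrow> a (pos x) \<noteq> 1"
  shows "\<exists>c. packing_coloring corona k c"
proof -
  define c :: "'a + 'a \<Rightarrow> nat" where "c z =
    (let p = a (pos (base z)) in
     if base z = sp (pos (base z)) then if isl z then p else if p = 1 then 2 else 1
     else if isl z then 1 else if p = 2 then 3 else 2)" for z
  \<comment> \<open>Color and depth of the vertices that may occur at a spine vertex of color \<open>p\<close>.\<close>
  define E :: "nat \<Rightarrow> (nat \<times> nat) set" where
    "E p = (if p = 1 then {(1, 0), (2, 1)} else {(p, 0), (1, 1), (if p = 2 then 3 else 2, 2)})" for p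
  have E: "(c z, depth z) \<in> E (a (pos (base z)))" if "base z \<in> pverts T" for z
    using no_leg[OF that] by (auto simp: c_def Let_def depth_def E_def)
  have range: "a i \<in> {1..k}" if "i < n" for i
    using a that by (auto simp: spine_coloring_def)
  have cross: "p < j - i + d + d'"
    if ij: "i < j" "j < n" and E: "(p, d) \<in> E (a i)" "(p, d') \<in> E (a j)" for i j p d d'
  proof -
    have far: "a i = a j \<Longrightarrow> a i < j - i" using a ij by (auto simp: spine_coloring_def)
    have "{a i, a j} \<noteq> {1, 2} \<and> {a i, a j} \<noteq> {2, 3}" if "j = Suc i"
      using a ij that by (auto simp: spine_coloring_def)
    then have "a i = 1 \<and> a j = 2 \<or> a i = 2 \<and> a j = 1 \<or> a i = 2 \<and> a j = 3 \<or> a i = 3 \<and> a j = 2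
        \<Longrightarrow> 2 \<le> j - i"
      using ij by (cases "j = Suc i") auto
    then show ?thesis using far ij E by (auto simp: E_def split: if_splits)
  qed
  have "packing_coloring corona k c"
  proof (rule packing_coloringI)
    fix z assume "base z \<in> pverts T"
    then show "c z \<in> {1..k}"
      using E[of z] range[of "pos (base z)"] pos_less[of "base z"] k
      by (auto simp: E_def split: if_splits)
  next
    fix x assume "x \<in> pverts T"
    then show "c (Inl x) \<noteq> c (Inr x)" by (auto simp: c_def Let_def)
  next
    fix z w assume zw: "base z \<in> pverts T" "base w \<in> pverts T" "base z \<noteq> base w" "c z = c w"
    let ?i = "pos (base z)" and ?j = "pos (base w)"
    have n: "?i < n" "?j < n" using zw pos_less by auto
    consider "?i < ?j" | "?j < ?i" | "?i = ?j" by linarith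
    then show "c z < tree_dist z w"
    proof cases
      case 1
      then show ?thesis
        using cross[OF 1 n(2), of "c z" "depth z" "depth w"] E[of z] E[of w] zw
        by (simp add: tree_dist_def)
    next
      case 2
      then show ?thesis
        using cross[OF 2 n(1), of "c z" "depth w" "depth z"] E[of z] E[of w] zw
        by (simp add: tree_dist_def)
    next
      case 3
      then show ?thesis
        using zw no_leg[of "base z"] no_leg[of "base w"]
        by (auto simp: tree_dist_def depth_def c_def Let_def split: if_splits)
    qed
  qed
  then show ?thesis by blast
qed

end

section \<open>Explicit spine colorings\<close>

text \<open>
  Executable forms of the conditions on a spine coloring, for words given as lists.
\<close>

fun far_from :: "nat \<Rightarrow> nat \<Rightarrow> nat list \<Rightarrow> bool" where
  "far_from t x [] \<longleftrightarrow> True"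
| "far_from t x (y # ys) \<longleftrightarrow> (x = y \<longrightarrow> x < t) \<and> far_from (Suc t) x ys"

fun spine_list :: "nat list \<Rightarrow> bool" where
  "spine_list [] \<longleftrightarrow> True"
| "spine_list (x # xs) \<longleftrightarrow> far_from 1 x xs \<and> spine_list xs \<and>
     (case xs of [] \<Rightarrow> True | y # _ \<Rightarrow> {x, y} \<noteq> {1, 2} \<and> {x, y} \<noteq> {2, 3})"

lemma far_from_nth:
  "far_from t x ys \<longleftrightarrow> (\<forall>j<length ys. x = ys ! j \<longrightarrow> x < t + j)"
proof (induction t x ys rule: far_from.induct)
  case (2 t x y ys)
  then show ?case by (simp add: All_less_Suc2)
qed simp

lemma spine_coloring_nth:
  assumes "spine_list xs" "set xs \<subseteq> {1..k}"
  shows "spine_coloring k (length xs) ((!) xs)"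
  using assms
proof (induction xs)
  case Nil
  then show ?case by (simp add: spine_coloring_def)
next
  case (Cons x xs)
  then have IH: "spine_coloring k (length xs) ((!) xs)"
    and far: "\<And>j. j < length xs \<Longrightarrow> x = xs ! j \<Longrightarrow> x < Suc j"
    and x: "x \<in> {1..k}"
    by (auto simp: far_from_nth)
  have adj: "xs \<noteq> [] \<Longrightarrow> {x, xs ! 0} \<noteq> {1, 2} \<and> {x, xs ! 0} \<noteq> {2, 3}"
    using Cons.prems(1) by (cases xs) auto
  have 1: "(x # xs) ! j \<in> {1..k} \<and>
        (\<forall>i<j. (x # xs) ! i = (x # xs) ! j \<longrightarrow> (x # xs) ! i < j - i)"
    if "j < length (x # xs)" for j
  proof (cases j)
    case (Suc j')
    then have "xs ! j' \<in> {1..k}" "\<forall>i<j'. xs ! i = xs ! j' \<longrightarrow> xs ! i < j' - i"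
      using IH that by (auto simp: spine_coloring_def)
    then show ?thesis
      using Suc far[of j'] that by (auto simp: less_Suc_eq_0_disj)
  qed (use x in simp)
  have 2: "{(x # xs) ! i, (x # xs) ! Suc i} \<noteq> {1, 2} \<and> {(x # xs) ! i, (x # xs) ! Suc i} \<noteq> {2, 3}"
    if "Suc i < length (x # xs)" for i
    using that IH adj by (cases i) (auto simp: spine_coloring_def)
  show ?case
    unfolding spine_coloring_def using 1 2 by blast
qed

text \<open>
  In the periodic word below the colors 2 and 3 recur every 4 steps, 4 and 5 every 6 steps, 6 and 7
  every 12 steps. As colors are at most 7, it suffices to check the distances below 8 within a period.
\<close>

lemma spine_coloring_seven: "\<exists>a. spine_coloring 7 n a \<and> (\<forall>i. a i \<noteq> 1)"
proof -
  define w where "w = [2, 4, 3, 5, 2, 6, 3, 4, 2, 5, 3, 7 :: nat]"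
  define a where "a i = w ! (i mod 12)" for i
  have len: "length w = 12" by (simp add: w_def)
  have set: "set w \<subseteq> {2..7}" by (simp add: w_def)
  have mem: "a i \<in> {2..7}" for i
    using set nth_mem[of "i mod 12" w] unfolding a_def len by fastforce
  have "\<forall>r\<in>set [0..<12]. \<forall>t\<in>set [1..<8]. w ! r = w ! ((r + t) mod 12) \<longrightarrow> w ! r < t"
    by (simp add: w_def upt_rec)
  then have per: "w ! r = w ! ((r + t) mod 12) \<Longrightarrow> w ! r < t" if "r < 12" "t \<in> {1..<8}" for r t
    using that by auto
  have far: "a i < j - i" if "i < j" "a i = a j" for i j
  proof (cases "j - i < 8")
    case True
    moreover obtain t where "j = i + t" "0 < t"
      using \<open>i < j\<close> less_imp_add_positive by metis
    ultimately have t: "j = i + t" "t \<in> {1..<8}" by auto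
    then have "w ! (i mod 12) = w ! ((i mod 12 + t) mod 12)"
      using that(2) by (simp add: a_def mod_add_left_eq)
    from per[OF _ t(2) this] show ?thesis by (simp add: a_def t(1))
  next
    case False
    then show ?thesis using mem[of i] by auto
  qed
  have "\<forall>r\<in>set [0..<12]. {w ! r, w ! ((r + 1) mod 12)} \<noteq> {2, 3}"
    by (simp add: w_def upt_rec doubleton_eq_iff)
  then have "{w ! (i mod 12), w ! ((i mod 12 + 1) mod 12)} \<noteq> {2, 3}" for i by simp
  then have "{a i, a (Suc i)} \<noteq> {2, 3}" for i
    by (simp add: a_def mod_Suc_eq)
  moreover have "1 \<notin> {a i, a (Suc i)}" for i
    using mem[of i] mem[of "Suc i"] by auto
  ultimately have adj: "{a i, a (Suc i)} \<noteq> {1, 2} \<and> {a i, a (Suc i)} \<noteq> {2, 3}" for i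
    by (metis insertI1)
  have "a i \<in> {1..7}" "a i \<noteq> 1" for i using mem[of i] by auto
  then show ?thesis
    using far adj by (intro exI[of _ a]) (simp add: spine_coloring_def)
qed

text \<open>
  A side of a deleted spine vertex \<open>v\<close> is the part of the spine to its left or to its right, with its
  vertices numbered 0, 1, and so on from the neighbor of \<open>v\<close>. A class of sides is a pair of a bound on
  the number of vertices and possibly the number of a vertex that is known to have no legs if it
  exists. The list \<open>sides k\<close> has the classes that cover all sides colored with \<open>k \<le> 4\<close> colors.
\<close>

definition sides :: "nat \<Rightarrow> (nat \<times> nat option) list" where
  "sides k =
     (if k = 1 then [(0, None)]
      else if k = 2 then [(1, None)]
      else if k = 3 then [(3, Some 0), (3, Some 2)]
      else [(5, None), (7, Some 1), (8, Some 2), (9, Some 3), (9, Some 4)])"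

text \<open>
  Words with \<open>k\<close> colors: every pair of classes in \<open>sides (k - 2)\<close> has a word here that suits it,
  possibly after reversal. They come from a search that extends words letter by letter and remembers
  how long ago each color occurred. The color 1 occurs only at vertices that the classes declare to
  have no legs.
\<close>

definition patterns :: "nat \<Rightarrow> nat list list" where
  "patterns k =
     (if k = 3 then [[3]]
      else if k = 4 then [[2, 4, 3]]
      else if k = 5 then [[1, 3, 4, 2, 5, 3, 1], [1, 4, 2, 5, 1, 3, 4], [2, 4, 1, 3, 1, 5, 2]]
      else
        [[2, 4, 3, 5, 2, 6, 3, 4, 2, 5, 3],
         [2, 5, 3, 4, 2, 6, 3, 1, 4, 2, 5, 3, 6],
         [3, 4, 2, 5, 3, 6, 2, 4, 1, 3, 5, 2, 4, 3],
         [3, 4, 2, 5, 3, 6, 2, 4, 3, 1, 5, 2, 4, 3, 6],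
         [2, 4, 3, 5, 2, 6, 3, 4, 2, 5, 1, 3, 4, 2, 6],
         [3, 4, 2, 5, 3, 1, 4, 2, 6, 3, 1, 4, 2, 5, 3, 6],
         [5, 3, 4, 2, 6, 1, 3, 4, 2, 5, 3, 1, 4, 2, 6, 3, 5],
         [3, 4, 2, 5, 3, 1, 4, 6, 3, 5, 2, 4, 1, 3, 6, 2, 4],
         [3, 4, 2, 5, 3, 1, 4, 6, 3, 5, 2, 4, 1, 3, 6, 2, 4, 3],
         [3, 4, 2, 5, 3, 1, 4, 2, 6, 3, 5, 2, 4, 1, 3, 6, 2, 4],
         [3, 4, 2, 5, 3, 1, 4, 2, 6, 3, 5, 2, 4, 1, 3, 6, 2, 4, 3],
         [3, 4, 2, 5, 3, 1, 4, 2, 6, 3, 5, 2, 4, 3, 1, 6, 2, 4, 3],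
         [3, 4, 2, 5, 1, 3, 4, 2, 6, 3, 5, 2, 4, 3, 1, 6, 2, 4, 3]])"

text \<open>
  The word is meant for a left side in class \<open>L\<close>, the vertex \<open>v\<close>, and a right side in class \<open>R\<close>, so \<open>v\<close> is
  at index \<open>fst L\<close>, and the numbering of the left side runs backwards.
\<close>

definition fits :: "nat \<times> nat option \<Rightarrow> nat \<times> nat option \<Rightarrow> nat list \<Rightarrow> bool" where
  "fits L R xs \<longleftrightarrow> length xs = fst L + 1 + fst R \<and>
     (\<forall>i\<in>set [0..<length xs]. xs ! i = 1 \<longrightarrow>
        (i < fst L \<and> snd L = Some (fst L - 1 - i)) \<or>
        (fst L < i \<and> snd R = Some (i - fst L - 1)))"

lemma patterns_are_spine_lists:
  "\<forall>k\<in>set [1, 2, 3, 4]. \<forall>xs\<in>set (patterns (k + 2)).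
     set xs \<subseteq> set [1..<k + 3] \<and> spine_list xs \<and> spine_list (rev xs)"
  by code_simp

lemma patterns_fit:
  "\<forall>k\<in>set [1, 2, 3, 4]. \<forall>L\<in>set (sides k). \<forall>R\<in>set (sides k).
     \<exists>xs\<in>set (patterns (k + 2) @ map rev (patterns (k + 2))). fits L R xs"
  by code_simp

lemma pattern_exists:
  assumes "k \<in> {1..4}" "L \<in> set (sides k)" "R \<in> set (sides k)"
  shows "\<exists>xs. spine_coloring (k + 2) (length xs) ((!) xs) \<and> fits L R xs"
proof -
  have k: "k \<in> set [1, 2, 3, 4]" using assms(1) by auto
  from patterns_fit[rule_format, OF k assms(2,3)]
  obtain xs where xs: "xs \<in> set (patterns (k + 2) @ map rev (patterns (k + 2)))" "fits L R xs" ..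
  have "set xs \<subseteq> set [1..<k + 3] \<and> spine_list xs"
    using xs(1) patterns_are_spine_lists[rule_format, OF k] by fastforce
  then have "spine_coloring (k + 2) (length xs) ((!) xs)"
    by (intro spine_coloring_nth) auto
  then show ?thesis using xs(2) by blast
qed

section \<open>The shape of a side that is colored with at most four colors\<close>

text \<open>
  A coloring of a side is recorded as a list of pairs, beginning at the neighbor of \<open>v\<close>: the color of a
  spine vertex and that of its pendant vertex. The latter matters only if the spine vertex has color 1,
  and is replaced by 1 otherwise, which keeps the search small: the color 1 at a
  pendant vertex is never in conflict with another spine vertex or its pendant vertex. The condition
  below is the packing condition for two spine vertices at distance \<open>t\<close> and their pendant vertices.
\<close>

definition compatible_at :: "nat \<Rightarrow> nat \<times> nat \<Rightarrow> nat \<times> nat \<Rightarrow> bool" where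
  "compatible_at t e e' \<longleftrightarrow>
     (fst e = fst e' \<longrightarrow> fst e < t) \<and> (fst e = snd e' \<longrightarrow> fst e < Suc t) \<and>
     (snd e = fst e' \<longrightarrow> snd e < Suc t) \<and> (snd e = snd e' \<longrightarrow> snd e < Suc (Suc t))"

fun compatible_all :: "nat \<Rightarrow> nat \<times> nat \<Rightarrow> (nat \<times> nat) list \<Rightarrow> bool" where
  "compatible_all t e [] \<longleftrightarrow> True"
| "compatible_all t e (e' # es) \<longleftrightarrow> compatible_at t e e' \<and> compatible_all (Suc t) e es"

definition entries :: "nat \<Rightarrow> (nat \<times> nat) list" where
  "entries k = map (\<lambda>p. (p, 1)) [2..<Suc k] @ map (Pair 1) [2..<Suc k]"

fun side_colorings :: "nat \<Rightarrow> nat \<Rightarrow> (nat \<times> nat) list list" where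
  "side_colorings k 0 = [[]]"
| "side_colorings k (Suc m) =
     [e # es. es \<leftarrow> side_colorings k m, e \<leftarrow> entries k, compatible_all 1 e es]"

definition side_matches :: "nat \<Rightarrow> (nat \<times> nat) list \<Rightarrow> nat \<times> nat option \<Rightarrow> bool" where
  "side_matches k es S \<longleftrightarrow> length es \<le> fst S \<and>
     (case snd S of None \<Rightarrow> True
      | Some t \<Rightarrow> t < length es \<longrightarrow> fst (es ! t) = 1 \<and> 2 \<le> length es \<and>
          (k = 4 \<longrightarrow> 1 \<le> t \<and> Suc t < length es))"

lemma no_long_side:
  "side_colorings 1 1 = []" "side_colorings 2 2 = []"
  "side_colorings 3 4 = []" "side_colorings 4 10 = []"
  by code_simp+

text \<open>
  Why this can be expected for \<open>k = 4\<close>: a path colored with 2, 3 and 4 only has at most four vertices,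
  so the color 1 appears early, and an inner spine vertex of color 1 has neighbors of all the colors
  2, 3 and 4, which leaves little freedom around it. There are 225 colorings in total,
  counting the empty one, and none with ten spine vertices.
\<close>

lemma short_side:
  "\<forall>k\<in>set [1, 2, 3, 4]. \<forall>m\<in>set [0..<10]. \<forall>es\<in>set (side_colorings k m).
     \<exists>S\<in>set (sides k). side_matches k es S"
  by code_simp

lemma compatible_all_nth:
  "compatible_all t e es \<longleftrightarrow> (\<forall>j<length es. compatible_at (t + j) e (es ! j))"
proof (induction t e es rule: compatible_all.induct)
  case (2 t e e' es)
  then show ?case by (simp add: All_less_Suc2)
qed simp

lemma side_colorings_complete:
  assumes "\<And>t. t < m \<Longrightarrow> f t \<in> set (entries k)"
    and "\<And>t u. t < u \<Longrightarrow> u < m \<Longrightarrow> compatible_at (u - t) (f t) (f u)"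
  shows "map f [0..<m] \<in> set (side_colorings k m)"
  using assms
proof (induction m arbitrary: f)
  case (Suc m)
  have tail: "map (f \<circ> Suc) [0..<m] \<in> set (side_colorings k m)"
    using Suc.prems(1) Suc.prems(2)[of "Suc _" "Suc _"] by (intro Suc.IH) auto
  have "map f [0..<Suc m] = f 0 # map (f \<circ> Suc) [0..<m]"
    by (simp add: map_upt_Suc comp_def del: upt_Suc)
  moreover have "compatible_all 1 (f 0) (map (f \<circ> Suc) [0..<m])"
    using Suc.prems(2)[of 0 "Suc _"] by (simp add: compatible_all_nth)
  ultimately show ?case
    using tail Suc.prems(1)[of 0] by auto
qed simp

lemma no_side_mono:
  assumes "side_colorings k m = []" "m \<le> n"
  shows "side_colorings k n = []"
  using assms(2,1) by (induction n rule: dec_induct) auto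

text \<open>
  The outcome of the search, for the colors \<open>P t\<close> of spine vertices and \<open>Q t\<close> of their pendant
  vertices. The extra conditions for \<open>k = 4\<close> say that the vertex of color 1 is an inner vertex of the
  side, and \<open>2 \<le> m\<close> gives it at least one neighbor there; both are needed to conclude that it has no
  legs.
\<close>

lemma side_exists:
  assumes k: "k \<in> {1..4}"
    and range: "\<And>t. t < m \<Longrightarrow> P t \<in> {1..k} \<and> Q t \<in> {1..k} \<and> P t \<noteq> Q t"
    and PP: "\<And>t u. t < u \<Longrightarrow> u < m \<Longrightarrow> P t = P u \<Longrightarrow> P t < u - t"
    and PQ: "\<And>t u. t < u \<Longrightarrow> u < m \<Longrightarrow> P t = Q u \<Longrightarrow> P t < Suc (u - t)"
    and QP: "\<And>t u. t < u \<Longrightarrow> u < m \<Longrightarrow> Q t = P u \<Longrightarrow> Q t < Suc (u - t)"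
    and QQ: "\<And>t u. t < u \<Longrightarrow> u < m \<Longrightarrow> Q t = Q u \<Longrightarrow> Q t < Suc (Suc (u - t))"
  shows "\<exists>S\<in>set (sides k). m \<le> fst S \<and>
    (\<forall>t. snd S = Some t \<and> t < m \<longrightarrow> P t = 1 \<and> 2 \<le> m \<and> (k = 4 \<longrightarrow> 1 \<le> t \<and> Suc t < m))"
proof -
  define f where "f t = (P t, if P t = 1 then Q t else 1)" for t
  have "f t \<in> set (entries k)" if "t < m" for t
    using range[OF that] by (auto simp: f_def entries_def)
  moreover have "compatible_at (u - t) (f t) (f u)" if "t < u" "u < m" for t u
    using PP[OF that] PQ[OF that] QP[OF that] QQ[OF that] that
    by (auto simp: f_def compatible_at_def)
  ultimately have *: "map f [0..<m] \<in> set (side_colorings k m)"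
    by (rule side_colorings_complete)
  have k': "k \<in> set [1, 2, 3, 4]" using k by auto
  have "k = 1 \<or> k = 2 \<or> k = 3 \<or> k = 4" using k by auto
  then have "side_colorings k 10 = []"
    using no_side_mono[OF no_long_side(1), of 10] no_side_mono[OF no_long_side(2), of 10]
      no_side_mono[OF no_long_side(3), of 10] no_long_side(4)
    by (elim disjE) (simp_all only: one_le_numeral numeral_le_iff semiring_norm simp_thms)
  then have "m < 10"
    using * no_side_mono[of k 10 m] by (cases "m < 10") auto
  then have m: "m \<in> set [0..<10]" by simp
  from short_side[rule_format, OF k' m *] obtain S
    where "S \<in> set (sides k)" "side_matches k (map f [0..<m]) S" ..
  then show ?thesis
    by (intro bexI[of _ S]) (auto simp: side_matches_def f_def)
qed

section \<open>Deleting a vertex of the corona\<close>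

context spined_tree
begin

abbreviation corona_del where "corona_del v \<equiv> pre_digraph.del_vert corona v"

lemma wf_corona_del: "wf_digraph (corona_del v)"
  by (rule wf_digraph.wf_digraph_del_vert[OF wf_corona])

lemma verts_corona_del [simp]: "z \<in> verts (corona_del v) \<longleftrightarrow> base z \<in> pverts T \<and> z \<noteq> v"
  by (simp add: pre_digraph.verts_del_vert)

lemma walk_within_corona_arc:
  assumes "(z, w) \<in> parcs (corona_K1 T)" "z \<noteq> v" "w \<noteq> v"
  shows "walk_within (corona_del v) z w 1" "walk_within (corona_del v) w z 1"
proof -
  interpret C: pair_graph "corona_K1 T" by (rule pair_graph_corona_K1) rule
  have "(w, z) \<in> parcs (corona_K1 T)" using assms(1) by (rule C.arcs_symmetric)
  then show "walk_within (corona_del v) z w 1" "walk_within (corona_del v) w z 1"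
    using assms wf_digraph.walk_within_arc[OF wf_corona_del[of v], of "(z, w)"]
      wf_digraph.walk_within_arc[OF wf_corona_del[of v], of "(w, z)"]
    by (auto simp: pre_digraph.del_vert_simps)
qed

lemma walk_within_spine:
  assumes "i \<le> j" "j < n" "\<And>t. i \<le> t \<Longrightarrow> t \<le> j \<Longrightarrow> Inl (sp t) \<noteq> v"
  shows "walk_within (corona_del v) (Inl (sp i)) (Inl (sp j)) (j - i) \<and>
    walk_within (corona_del v) (Inl (sp j)) (Inl (sp i)) (j - i)"
  using assms
proof (induction j rule: dec_induct)
  case base
  then show ?case
    using wf_digraph.walk_within_refl[OF wf_corona_del] sp_in by simp
next
  case (step j)
  have arc: "(Inl (sp j), Inl (sp (Suc j))) \<in> parcs (corona_K1 T)"
    using sp_arc step by (simp add: corona_arc_iff)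
  have ne: "Inl (sp j) \<noteq> v" "Inl (sp (Suc j)) \<noteq> v" using step.prems(2) step.hyps by auto
  have IH: "walk_within (corona_del v) (Inl (sp i)) (Inl (sp j)) (j - i)"
    "walk_within (corona_del v) (Inl (sp j)) (Inl (sp i)) (j - i)"
    using step.IH step.prems by auto
  have "Suc j - i = (j - i) + 1" "Suc j - i = 1 + (j - i)" using step.hyps by auto
  then show ?case
    using wf_digraph.walk_within_trans[OF wf_corona_del IH(1) walk_within_corona_arc(1)[OF arc ne]]
      wf_digraph.walk_within_trans[OF wf_corona_del walk_within_corona_arc(2)[OF arc ne] IH(2)]
    by metis
qed

lemma walk_within_to_spine:
  assumes "base z \<in> pverts T" "z \<noteq> v" "Inl (base z) \<noteq> v" "Inl (sp (pos (base z))) \<noteq> v"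
  shows "walk_within (corona_del v) z (Inl (sp (pos (base z)))) (depth z) \<and>
    walk_within (corona_del v) (Inl (sp (pos (base z)))) z (depth z)"
proof -
  let ?H = "corona_del v" and ?x = "Inl (base z)" and ?s = "Inl (sp (pos (base z)))"
  note trans = wf_digraph.walk_within_trans[OF wf_corona_del]
  define d1 :: nat where "d1 = (if isl z then 0 else 1)"
  define d2 :: nat where "d2 = (if base z = sp (pos (base z)) then 0 else 1)"
  have 1: "walk_within ?H z ?x d1 \<and> walk_within ?H ?x z d1"
  proof (cases z)
    case (Inl x)
    then show ?thesis
      using wf_digraph.walk_within_refl[OF wf_corona_del, of z v d1] assms by simp
  next
    case (Inr x)
    then show ?thesis
      using walk_within_corona_arc[of z ?x v] assms by (simp add: corona_arc_iff d1_def)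
  qed
  have 2: "walk_within ?H ?x ?s d2 \<and> walk_within ?H ?s ?x d2"
  proof (cases "base z = sp (pos (base z))")
    case True
    then show ?thesis
      using wf_digraph.walk_within_refl[OF wf_corona_del, of ?x v d2] assms by simp
  next
    case False
    then show ?thesis
      using walk_within_corona_arc[of ?x ?s v] leg_arc[OF assms(1)] assms
      by (simp add: corona_arc_iff d2_def)
  qed
  have "depth z = d1 + d2" "depth z = d2 + d1" by (auto simp: depth_def d1_def d2_def)
  then show ?thesis using 1 2 trans by metis
qed

lemma walk_within_tree_dist:
  assumes z: "base z \<in> pverts T" "z \<noteq> v" "Inl (base z) \<noteq> v"
    and w: "base w \<in> pverts T" "w \<noteq> v" "Inl (base w) \<noteq> v"
    and between: "\<And>t. pos (base z) \<le> t \<and> t \<le> pos (base w) \<or> pos (base w) \<le> t \<and> t \<le> pos (base z) \<Longrightarrow>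
      Inl (sp t) \<noteq> v"
  shows "walk_within (corona_del v) z w (tree_dist z w)"
proof -
  let ?H = "corona_del v" and ?i = "pos (base z)" and ?j = "pos (base w)"
  note trans = wf_digraph.walk_within_trans[OF wf_corona_del]
  have "walk_within ?H (Inl (sp ?i)) (Inl (sp ?j)) ((?i - ?j) + (?j - ?i))"
  proof (cases "?i \<le> ?j")
    case True
    then show ?thesis
      using walk_within_spine[OF True pos_less[OF w(1)], of v] between by simp
  next
    case False
    then show ?thesis
      using walk_within_spine[of ?j ?i v] pos_less[OF z(1)] between by simp
  qed
  moreover have "walk_within ?H z (Inl (sp ?i)) (depth z)" "walk_within ?H (Inl (sp ?j)) w (depth w)"
    using walk_within_to_spine[OF z] walk_within_to_spine[OF w] between[of ?i] between[of ?j]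
      nat_le_linear[of ?i ?j] by auto
  ultimately have "walk_within ?H z w (depth z + ((?i - ?j) + (?j - ?i)) + depth w)"
    using trans by blast
  then show ?thesis by (simp add: tree_dist_def ac_simps)
qed

lemma color_range:
  assumes "packing_coloring (corona_del v) k c" "base z \<in> pverts T" "z \<noteq> v"
  shows "c z \<in> {1..k}"
proof -
  have "z \<in> verts (corona_del v)" using assms(2,3) by simp
  then show ?thesis using assms(1) unfolding packing_coloring_def by blast
qed

lemma color_less_walk:
  assumes c: "packing_coloring (corona_del v) k c"
    and zw: "base z \<in> pverts T" "base w \<in> pverts T" "z \<noteq> v" "w \<noteq> v" "z \<noteq> w" "c z = c w"
    and d: "walk_within (corona_del v) z w d"
  shows "c z < d"
proof -
  have "c z \<in> {1..k}" using color_range[OF c] zw by blast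
  then have "ereal (real (c z)) < graph_dist (corona_del v) z w"
    using c zw unfolding packing_coloring_def by auto
  also have "\<dots> \<le> ereal (real d)"
    by (rule wf_digraph.graph_dist_le_walk_within[OF wf_corona_del d])
  finally show ?thesis by simp
qed

lemma color_pendant:
  assumes c: "packing_coloring (corona_del v) k c" and x: "x \<in> pverts T" "Inl x \<noteq> v" "Inr x \<noteq> v"
  shows "c (Inl x) \<noteq> c (Inr x)"
proof
  assume "c (Inl x) = c (Inr x)"
  moreover have "walk_within (corona_del v) (Inl x) (Inr x) 1"
    using walk_within_corona_arc(1)[of "Inl x" "Inr x" v] x by (simp add: corona_arc_iff)
  ultimately have "c (Inl x) < 1"
    using color_less_walk[OF c, of "Inl x" "Inr x" 1] x by simp
  then show False using color_range[OF c, of "Inl x"] x by simp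
qed

text \<open>
  The vertex \<open>v\<close> gets the new color. If \<open>v\<close> is the inner vertex of a leg, then its pendant vertex is isolated
  in the smaller graph, so that its old color means nothing; it is recolored with 1, which is possible
  because \<open>v\<close> is its only neighbor.
\<close>

lemma one_more_color_off_spine:
  assumes c: "packing_coloring (corona_del v) k c"
    and off: "\<And>i. i < n \<Longrightarrow> v \<noteq> Inl (sp i)"
  shows "\<exists>c'. packing_coloring corona (k + 1) c'"
proof -
  define c' where "c' z = (if z = v then k + 1 else if v = Inl (base z) then 1 else c z)" for z
  note rng = color_range[OF c]
  have c'_le: "c' z \<in> {1..k}" if "base z \<in> pverts T" "z \<noteq> v" for z
    using rng[OF that] that(2) by (simp add: c'_def)
  have c'_v: "c' v = k + 1" by (simp add: c'_def)
  have neq_v: "z \<noteq> v" if "base z \<in> pverts T" "base w \<in> pverts T" "z \<noteq> w" "c' z = c' w" for z w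
  proof
    assume "z = v"
    then have "c' w \<in> {1..k}" using c'_le[OF that(2)] that(3) by blast
    then show False using that(4) \<open>z = v\<close> c'_v by simp
  qed
  have "packing_coloring corona (k + 1) c'"
  proof (rule packing_coloringI)
    fix z assume "base z \<in> pverts T"
    then show "c' z \<in> {1..k + 1}" using c'_le[of z] c'_v by (cases "z = v") auto
  next
    fix x assume x: "x \<in> pverts T"
    show "c' (Inl x) \<noteq> c' (Inr x)"
    proof
      assume eq: "c' (Inl x) = c' (Inr x)"
      have "Inl x \<noteq> v" "Inr x \<noteq> v"
        using neq_v[of "Inl x" "Inr x"] neq_v[of "Inr x" "Inl x"] x eq by simp_all
      then show False using color_pendant[OF c x] eq by (simp add: c'_def)
    qed
  next
    fix z w
    assume zw: "base z \<in> pverts T" "base w \<in> pverts T" "base z \<noteq> base w" and eq: "c' z = c' w"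
    have "z \<noteq> w" using zw(3) by blast
    then have ne: "z \<noteq> v" "w \<noteq> v"
      using neq_v[OF zw(1,2)] neq_v[OF zw(2,1)] eq by (blast, metis)
    show "c' z < tree_dist z w"
    proof (cases "v = Inl (base z) \<or> v = Inl (base w)")
      case True
      have deep: "2 \<le> depth y" if "v = Inl (base y)" "y \<noteq> v" "base y \<in> pverts T" for y
      proof -
        have "base y \<noteq> sp (pos (base y))"
          using off[OF pos_less[OF that(3)]] that(1) by simp
        moreover have "\<not> isl y" using that(1,2) by (cases y) auto
        ultimately show ?thesis by (simp add: depth_def)
      qed
      have "c' z = 1" using True ne eq by (elim disjE) (simp_all add: c'_def)
      moreover have "2 \<le> depth z \<or> 2 \<le> depth w"
        using True deep[of z] deep[of w] ne zw by blast
      ultimately show ?thesis unfolding tree_dist_def by linarith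
    next
      case False
      have not_v: "Inl (sp t) \<noteq> v" if "t \<le> pos (base z) \<or> t \<le> pos (base w)" for t
      proof -
        have "t < n" using that pos_less[OF zw(1)] pos_less[OF zw(2)] by auto
        then show ?thesis using off by metis
      qed
      have "walk_within (corona_del v) z w (tree_dist z w)"
        using zw(1,2) ne False not_v by (intro walk_within_tree_dist) auto
      moreover have "c' z = c z" "c' w = c w" using False ne by (simp_all add: c'_def)
      ultimately show ?thesis
        using color_less_walk[OF c zw(1,2) ne \<open>z \<noteq> w\<close>] eq by simp
    qed
  qed
  then show ?thesis by blast
qed

text \<open>
  Here \<open>g\<close> numbers the vertices of a side. The vertex \<open>sp (g t)\<close> singled out by the class has color 1.
  Its pendant vertex, its neighbors on the side and the inner vertex of a leg have distance 1
  to it and 2 to each other, so they have different colors from 2 to \<open>k\<close>. Without a leg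
  there are already at least \<open>k - 1\<close> of them: the pendant vertex and, for \<open>k = 4\<close>, two neighbors on the
  side, or, for \<open>k = 3\<close>, one.
\<close>

lemma side_shape:
  assumes c: "packing_coloring (corona_del (Inl (sp i))) k c" and k: "k \<in> {1..4}"
    and g: "\<And>t. t < m \<Longrightarrow> g t < n"
    and away: "(\<forall>t<m. g t < i) \<or> (\<forall>t<m. i < g t)"
    and gap: "\<And>t u. t < u \<Longrightarrow> u < m \<Longrightarrow> (g t - g u) + (g u - g t) = u - t"
    and i: "i < n"
  shows "\<exists>S\<in>set (sides k). m \<le> fst S \<and> (\<forall>t x. snd S = Some t \<and> t < m \<and>
    x \<in> pverts T \<and> pos x = g t \<longrightarrow> x = sp (g t))"
proof -
  let ?v = "Inl (sp i) :: 'a + 'a"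
  have pos_g: "pos (sp (g t)) = g t" "sp (g t) \<in> pverts T" if "t < m" for t
    using g that pos_sp sp_in by auto
  have sep: "c z < tree_dist z w"
    if "base z \<in> pverts T" "base w \<in> pverts T" "pos (base z) = g t" "pos (base w) = g u"
      "t < m" "u < m" "z \<noteq> w" "c z = c w" for z w t u
  proof -
    have g_ne: "g t \<noteq> i" "g u \<noteq> i" using away that by auto
    then have ne: "Inl (base z) \<noteq> ?v" "Inl (base w) \<noteq> ?v" "z \<noteq> ?v" "w \<noteq> ?v"
      using that pos_sp[OF i] by auto
    have "Inl (sp r) \<noteq> ?v" if r: "g t \<le> r \<and> r \<le> g u \<or> g u \<le> r \<and> r \<le> g t" for r
    proof -
      have "r < n" using r g[OF \<open>t < m\<close>] g[OF \<open>u < m\<close>] by auto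
      moreover have "r \<noteq> i" using r away \<open>t < m\<close> \<open>u < m\<close> by fastforce
      ultimately show ?thesis using pos_sp i by (metis sum.inject(1))
    qed
    then have "walk_within (corona_del ?v) z w (tree_dist z w)"
      using that ne by (intro walk_within_tree_dist) auto
    then show ?thesis using color_less_walk[OF c] that ne by blast
  qed
  have ne_v: "sp (g t) \<noteq> sp i" if "t < m" for t
    using away that pos_g(1)[OF that] pos_sp[OF i] by (metis less_irrefl)
  define P where "P t = c (Inl (sp (g t)))" for t
  define Q where "Q t = c (Inr (sp (g t)))" for t
  have depths: "depth (Inl (sp (g t))) = 0" "depth (Inr (sp (g t))) = 1" if "t < m" for t
    using pos_g[OF that] by (auto simp: depth_def)
  have "\<exists>S\<in>set (sides k). m \<le> fst S \<and>
    (\<forall>t. snd S = Some t \<and> t < m \<longrightarrow> P t = 1 \<and> 2 \<le> m \<and> (k = 4 \<longrightarrow> 1 \<le> t \<and> Suc t < m))"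
  proof (rule side_exists[OF k])
    fix t assume t: "t < m"
    show "P t \<in> {1..k} \<and> Q t \<in> {1..k} \<and> P t \<noteq> Q t"
      using color_range[OF c, of "Inl (sp (g t))"] color_range[OF c, of "Inr (sp (g t))"]
        color_pendant[OF c, of "sp (g t)"] pos_g[OF t] ne_v[OF t]
      by (simp add: P_def Q_def)
  next
    fix t u assume tu: "t < u" "u < m"
    then have t: "t < m" by simp
    have ne: "sp (g t) \<noteq> sp (g u)"
    proof
      assume "sp (g t) = sp (g u)"
      then have "g t = g u" using pos_g(1)[OF t] pos_g(1)[OF tu(2)] by metis
      then show False using gap[OF tu] tu(1) by simp
    qed
    have sep': "c z < u - t + depth z + depth w"
      if "base z = sp (g t)" "base w = sp (g u)" "c z = c w" for z w
    proof -
      have "z \<noteq> w" using that ne by auto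
      then have "c z < tree_dist z w"
        using that pos_g[OF t] pos_g[OF tu(2)] by (intro sep[OF _ _ _ _ t tu(2)]) auto
      then show ?thesis
        unfolding tree_dist_def that(1,2) pos_g(1)[OF t] pos_g(1)[OF tu(2)] gap[OF tu] .
    qed
    note d = depths[OF t] depths[OF tu(2)]
    show "P t < u - t" if "P t = P u"
      using sep'[of "Inl (sp (g t))" "Inl (sp (g u))"] that unfolding P_def d by simp
    show "P t < Suc (u - t)" if "P t = Q u"
      using sep'[of "Inl (sp (g t))" "Inr (sp (g u))"] that unfolding P_def Q_def d by simp
    show "Q t < Suc (u - t)" if "Q t = P u"
      using sep'[of "Inr (sp (g t))" "Inl (sp (g u))"] that unfolding P_def Q_def d by simp
    show "Q t < Suc (Suc (u - t))" if "Q t = Q u"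
      using sep'[of "Inr (sp (g t))" "Inr (sp (g u))"] that unfolding Q_def d by simp
  qed
  then obtain S where S: "S \<in> set (sides k)" "m \<le> fst S"
    and light: "\<And>t. snd S = Some t \<Longrightarrow> t < m \<Longrightarrow>
      P t = 1 \<and> 2 \<le> m \<and> (k = 4 \<longrightarrow> 1 \<le> t \<and> Suc t < m)"
    by blast
  have "x = sp (g t)" if t: "snd S = Some t" "t < m" and x: "x \<in> pverts T" "pos x = g t" for t x
  proof (rule ccontr)
    assume leg: "x \<noteq> sp (g t)"
    \<comment> \<open>Neighbors of \<open>sp (g t)\<close> in the corona; there are more of them than colors from 2 to \<open>k\<close>.\<close>
    define N where "N = {Inl x, Inr (sp (g t))} \<union>
      (\<lambda>u. Inl (sp (g u))) ` {u. u < m \<and> (u = Suc t \<or> t = Suc u)}"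
    have N: "base z \<in> pverts T \<and> (\<exists>u<m. pos (base z) = g u) \<and> z \<noteq> Inl (sp (g t)) \<and>
      tree_dist z (Inl (sp (g t))) = 1" if "z \<in> N" for z
    proof -
      consider "z = Inl x" | "z = Inr (sp (g t))"
        | u where "z = Inl (sp (g u))" "u < m" "u = Suc t \<or> t = Suc u"
        using \<open>z \<in> N\<close> by (auto simp: N_def)
      then show ?thesis
      proof cases
        case 3
        then have one: "(g u - g t) + (g t - g u) = 1"
          using gap[of t u] gap[of u t] t(2) by auto
        have d: "tree_dist z (Inl (sp (g t))) = 1"
          unfolding tree_dist_def 3(1) base_simps pos_g(1)[OF 3(2)] pos_g(1)[OF t(2)]
            depths(1)[OF 3(2)] depths(1)[OF t(2)] one by simp
        have "sp (g u) \<noteq> sp (g t)"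
          using pos_g(1)[OF 3(2)] pos_g(1)[OF t(2)] one
          by (metis add_cancel_right_left diff_self_eq_0 zero_neq_one)
        then show ?thesis using d 3(1,2) pos_g[OF 3(2)] by (metis base_simps(1))
      qed (use x t leg pos_g[OF t(2)] depths[OF t(2)] in \<open>auto simp: tree_dist_def depth_def\<close>)
    qed
    have color_ge: "c z \<in> {2..k}" if zN: "z \<in> N" for z
    proof -
      obtain u where u: "u < m" "pos (base z) = g u" using N[OF zN] by blast
      have "c z \<noteq> 1"
      proof
        assume "c z = 1"
        then have "c z = c (Inl (sp (g t)))" using light[OF t] by (simp add: P_def)
        then have "c z < tree_dist z (Inl (sp (g t)))"
          using N[OF zN] u pos_g[OF t(2)] by (intro sep[OF _ _ u(2) _ u(1) t(2)]) auto
        then show False using N[OF zN] \<open>c z = 1\<close> by simp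
      qed
      moreover have "z \<noteq> ?v"
        using away u N[OF zN] pos_sp[OF i] by (metis base_simps(1) less_irrefl)
      ultimately show ?thesis using color_range[OF c, of z] N[OF zN] by auto
    qed
    have inj: "inj_on c N"
    proof (rule inj_onI, rule ccontr)
      fix z w assume zw: "z \<in> N" "w \<in> N" "c z = c w" "z \<noteq> w"
      obtain u u' where u: "u < m" "pos (base z) = g u" "u' < m" "pos (base w) = g u'"
        using N[OF zw(1)] N[OF zw(2)] by blast
      have "c z < tree_dist z w"
        using N[OF zw(1)] N[OF zw(2)] zw by (intro sep[OF _ _ u(2,4,1,3)]) auto
      also have "\<dots> \<le> tree_dist z (Inl (sp (g t))) + tree_dist w (Inl (sp (g t)))"
        unfolding tree_dist_def by arith
      also have "\<dots> = 2" using N[OF zw(1)] N[OF zw(2)] by simp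
      finally show False using color_ge[OF zw(1)] by simp
    qed
    have "c ` N \<subseteq> {2..k}" using color_ge by blast
    moreover have fin: "finite N" by (simp add: N_def)
    ultimately have card: "card N \<le> k - 1"
      using card_inj_on_le[OF inj, of "{2..k}"] by simp
    have sub_card: "length zs \<le> card N" if "distinct zs" "set zs \<subseteq> N" for zs
      using card_mono[OF fin that(2)] distinct_card[OF that(1)] by simp
    have k34: "k = 3 \<or> k = 4"
      using S(1) t(1) k by (auto simp: sides_def split: if_splits)
    have in_N: "Inl x \<in> N" "Inr (sp (g t)) \<in> N"
      "\<And>u. u < m \<Longrightarrow> u = Suc t \<or> t = Suc u \<Longrightarrow> Inl (sp (g u)) \<in> N"
      by (auto simp: N_def)
    have x_ne: "x \<noteq> sp (g u)" if "u < m" "u = Suc t \<or> t = Suc u" for u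
    proof
      assume "x = sp (g u)"
      then have "g u = g t" using pos_g(1)[OF that(1)] x(2) by simp
      then show False using gap[of t u] gap[of u t] that t(2) by auto
    qed
    show False
    proof (cases "k = 4")
      case True
      then obtain u where u: "t = Suc u" "Suc t < m"
        using light[OF t] by (cases t) auto
      have "sp (g u) \<noteq> sp (g (Suc t))"
      proof
        assume "sp (g u) = sp (g (Suc t))"
        then have "g u = g (Suc t)" using pos_g(1)[of u] pos_g(1)[OF u(2)] u by simp
        then show False using gap[of u "Suc t"] u by simp
      qed
      then show False
        using sub_card[of "[Inl x, Inr (sp (g t)), Inl (sp (g u)), Inl (sp (g (Suc t)))]"]
          in_N(1,2) in_N(3)[of u] in_N(3)[of "Suc t"] x_ne[of u] x_ne[of "Suc t"] u card True
        by simp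
    next
      case False
      have "\<exists>u<m. u = Suc t \<or> t = Suc u"
      proof (cases t)
        case 0
        then show ?thesis using light[OF t] by (intro exI[of _ "Suc t"]) auto
      next
        case (Suc t')
        then show ?thesis using t(2) by (intro exI[of _ t']) auto
      qed
      then obtain u where u: "u < m" "u = Suc t \<or> t = Suc u" by blast
      then show False
        using sub_card[of "[Inl x, Inr (sp (g t)), Inl (sp (g u))]"]
          in_N(1,2) in_N(3)[OF u] x_ne[OF u] card False k34 by simp
    qed
  qed
  then show ?thesis using S by blast
qed


text \<open>
  A word for the classes of the two sides is placed on the spine so that the letter at index \<open>fst L\<close>
  falls on the deleted vertex; if the sides are shorter than their bounds, it overhangs at the ends.
\<close>

lemma two_more_colors_on_spine:
  assumes c: "packing_coloring (corona_del (Inl (sp i))) k c" and i: "i < n" and k: "k \<le> 4"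
  shows "\<exists>c'. packing_coloring corona (k + 2) c'"
proof -
  \<comment> \<open>The pendant vertex of the deleted vertex remains, hence there is at least one color.\<close>
  have "base (Inr (sp i)) \<in> pverts T" using sp_in[OF i] by simp
  then have "c (Inr (sp i)) \<in> {1..k}" by (rule color_range[OF c]) simp
  then have k: "k \<in> {1..4}" using k by simp
  obtain L where L: "L \<in> set (sides k)" "i \<le> fst L"
    and no_leg_L: "\<And>t x. snd L = Some t \<Longrightarrow> t < i \<Longrightarrow> x \<in> pverts T \<Longrightarrow> pos x = i - 1 - t \<Longrightarrow>
      x = sp (i - 1 - t)"
    using side_shape[OF c k, of i "\<lambda>t. i - 1 - t"] i by fastforce
  obtain R where R: "R \<in> set (sides k)" "n - 1 - i \<le> fst R"
    and no_leg_R: "\<And>t x. snd R = Some t \<Longrightarrow> t < n - 1 - i \<Longrightarrow> x \<in> pverts T \<Longrightarrow> pos x = i + 1 + t \<Longrightarrow>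
      x = sp (i + 1 + t)"
    using side_shape[OF c k, of "n - 1 - i" "\<lambda>t. i + 1 + t"] i by fastforce
  obtain xs where xs: "spine_coloring (k + 2) (length xs) ((!) xs)" "fits L R xs"
    using pattern_exists[OF k L(1) R(1)] by blast
  let ?a = "\<lambda>j. xs ! (j + (fst L - i))"
  have len: "length xs = fst L + 1 + fst R" using xs(2) by (simp add: fits_def)
  show ?thesis
  proof (rule packing_coloring_of_spine_coloring)
    show "spine_coloring (k + 2) n ?a"
      using xs(1) by (rule spine_coloring_shift) (use len L(2) R(2) i in simp)
    show "3 \<le> k + 2" using k by simp
    fix x assume x: "x \<in> pverts T" "x \<noteq> sp (pos x)"
    let ?r = "pos x + (fst L - i)"
    have r: "?r < length xs" using pos_less[OF x(1)] len L(2) R(2) i by simp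
    show "?a (pos x) \<noteq> 1"
    proof
      assume "?a (pos x) = 1"
      then consider "?r < fst L" "snd L = Some (fst L - 1 - ?r)"
        | "fst L < ?r" "snd R = Some (?r - fst L - 1)"
        using xs(2) r by (auto simp: fits_def)
      then show False
      proof cases
        case 1
        then have "pos x < i" "fst L - 1 - ?r = i - 1 - pos x" using L(2) by auto
        then show False using no_leg_L[of "i - 1 - pos x" x] 1(2) x by simp
      next
        case 2
        then have "i < pos x" "?r - fst L - 1 = pos x - i - 1" using L(2) by auto
        moreover from this have "pos x - i - 1 < n - 1 - i" using pos_less[OF x(1)] by arith
        ultimately show False using no_leg_R[of "pos x - i - 1" x] 2(2) x by simp
      qed
    qed
  qed
qed

lemma corona_seven_colorable: "\<exists>c. packing_coloring corona 7 c"
proof -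
  obtain a where a: "spine_coloring 7 n a" "\<And>i. a i \<noteq> 1"
    using spine_coloring_seven by blast
  then show ?thesis by (intro packing_coloring_of_spine_coloring[OF a(1)]) auto
qed

lemma two_more_colors:
  assumes c: "packing_coloring (corona_del v) k c"
  shows "\<exists>c'. packing_coloring corona (k + 2) c'"
proof (cases "\<exists>i<n. v = Inl (sp i)")
  case True
  then obtain i where i: "i < n" "v = Inl (sp i)" by blast
  show ?thesis
  proof (cases "k \<le> 4")
    case True
    then show ?thesis using two_more_colors_on_spine c i by blast
  next
    case False
    then have "7 \<le> k + 2" by simp
    then show ?thesis using corona_seven_colorable packing_coloring_mono by blast
  qed
next
  case False
  then obtain c' where "packing_coloring corona (k + 1) c'"
    using one_more_color_off_spine[OF c] by blast
  then have "packing_coloring corona (k + 2) c'" by (rule packing_coloring_mono) simp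
  then show ?thesis by blast
qed

end

theorem theorem3:
  fixes T :: "'a pair_pre_digraph"
  assumes "caterpillar T"
  shows "packing_coloring_gap (with_proj (corona_K1 T)) \<le> 2"
proof -
  obtain n sp pos where "spined_tree T n sp pos"
    using caterpillar_imp_spined_tree[OF assms] by blast
  then interpret spined_tree T n sp pos .
  interpret C: pair_graph "corona_K1 T" by (rule pair_graph_corona_K1) rule
  have gap: "int (packing_chromatic_number corona) -
      int (packing_chromatic_number (corona_del v)) \<le> 2" for v
  proof -
    have "finite (verts (corona_del v))"
      using C.pair_finite_verts by (simp add: pre_digraph.verts_del_vert)
    then obtain c where
      "packing_coloring (corona_del v) (packing_chromatic_number (corona_del v)) c"
      using packing_coloring_exists LeastI_ex[of "\<lambda>k. \<exists>c. packing_coloring (corona_del v) k c"]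
      unfolding packing_chromatic_number_def by blast
    from two_more_colors[OF this]
    have "packing_chromatic_number corona \<le> packing_chromatic_number (corona_del v) + 2"
      unfolding packing_chromatic_number_def[of corona] by (rule Least_le)
    then show ?thesis by simp
  qed
  have "pverts T \<noteq> {}"
    using assms by (auto simp: caterpillar_def vpath_def vwalk_def)
  then have "verts corona \<noteq> {}" by (auto simp: corona_K1_def)
  then show ?thesis
    unfolding packing_coloring_gap_def using gap C.pair_finite_verts
    by (subst Max_le_iff) auto
qed

end
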